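(* Let $A$ be a real $n\times n$ matrix and $u_0\in\mathbb{R}^n$. Suppose that $$(1-\epsilon)\,A D_A(u_0) A^T \preceq \widehat{M}\preceq (1+\epsilon)\,A D_A(u_0)A^T,$$ and let $\widehat{M}=BB^T$, where $B$ is an invertible $n\times n$ matrix. Then there is a rotation matrix $R^*$ such that $$\|B^{-1}A D_A(u_0)^{1/2}-R^*\|_F\le\sqrt{n}\,\epsilon .$$
   Context: $A_k$ denotes the $k$-th column of $A$, and $D_A(u)$ is the $n\times n$ diagonal matrix whose $k$-th diagonal entry is $24(A_k\cdot u)^2$. $\preceq$ is the Loewner (positive semidefinite) order and $\|\cdot\|_F$ is the Frobenius norm. "Rotation matrix" means real orthogonal matrix.
   Formalization: The added assumption ε ≤ (√5−1)/2 is needed: for every larger ε the claim fails, e.g. A = aI, B = I, u_0 with all entries 1/(a√24), where a = 1/√(1−ε) if ε < 1 and a > 1+ε if ε ≥ 1. *)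

theory Defs
  imports "HOL-Analysis.Analysis"
begin

definition psd :: "real^'n^'n \<Rightarrow> bool" where
  "psd M \<longleftrightarrow> transpose M = M \<and> (\<forall>x. 0 \<le> x \<bullet> (M *v x))"

definition loewner_le :: "real^'n^'n \<Rightarrow> real^'n^'n \<Rightarrow> bool" (infix "\<preceq>" 50) where
  "M \<preceq> N \<longleftrightarrow> psd (N - M)"

definition D_mat :: "real^'n^'n \<Rightarrow> real^'n \<Rightarrow> real^'n^'n" where
  "D_mat A u = (\<chi> i j. if i = j then 24 * (column i A \<bullet> u)^2 else 0)"

text \<open>Square root of a diagonal matrix with nonnegative entries; off-diagonal entries of the
  argument are ignored. The two lemmas on \<open>D_mat\<close> below show that there it is the
  positive semidefinite square root.\<close>

definition diag_sqrt :: "real^'n^'n \<Rightarrow> real^'n^'n" where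
  "diag_sqrt D = (\<chi> i j. if i = j then sqrt (D $ i $ i) else 0)"

lemma diag_sqrt_D_mat_square:
  "diag_sqrt (D_mat A u) ** diag_sqrt (D_mat A u) = D_mat A u"
proof -
  have "(diag_sqrt (D_mat A u) ** diag_sqrt (D_mat A u)) $ i $ j = D_mat A u $ i $ j" for i j
  proof -
    have "(diag_sqrt (D_mat A u) ** diag_sqrt (D_mat A u)) $ i $ j =
        (\<Sum>k\<in>UNIV. if i = k then
           sqrt (D_mat A u $ i $ i) * (if i = j then sqrt (D_mat A u $ i $ i) else 0) else 0)"
      unfolding diag_sqrt_def matrix_matrix_mult_def by (simp only: vec_lambda_beta, intro sum.cong) auto
    also have "\<dots> = D_mat A u $ i $ j"
      by (subst sum.delta') (auto simp: D_mat_def)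
    finally show ?thesis .
  qed
  then show ?thesis by (simp add: vec_eq_iff)
qed

lemma psd_diag_sqrt_D_mat: "psd (diag_sqrt (D_mat A u))"
proof -
  have "(diag_sqrt (D_mat A u) *v x) $ i = sqrt (D_mat A u $ i $ i) * x $ i" for x i
  proof -
    have "(diag_sqrt (D_mat A u) *v x) $ i =
        (\<Sum>k\<in>UNIV. if i = k then sqrt (D_mat A u $ i $ i) * x $ i else 0)"
      unfolding diag_sqrt_def matrix_vector_mult_def by (simp only: vec_lambda_beta, intro sum.cong) auto
    then show ?thesis by (simp add: sum.delta')
  qed
  moreover have "0 \<le> x * (sqrt (D_mat A u $ i $ i) * x)" for x :: real and i
  proof -
    have "0 \<le> sqrt (D_mat A u $ i $ i) * (x * x)"
      by (rule mult_nonneg_nonneg) (simp_all add: D_mat_def)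
    then show ?thesis by (simp only: mult.left_commute)
  qed
  ultimately have "0 \<le> x \<bullet> (diag_sqrt (D_mat A u) *v x)" for x
    unfolding inner_vec_def by (intro sum_nonneg) simp
  moreover have "transpose (diag_sqrt (D_mat A u)) = diag_sqrt (D_mat A u)"
    by (simp add: diag_sqrt_def transpose_def vec_eq_iff)
  ultimately show ?thesis by (simp add: psd_def)
qed

text \<open>The library norm on \<^typ>\<open>real^'n^'m\<close> is the Frobenius norm.\<close>

lemma norm_matrix_eq_frobenius:
  fixes M :: "real^'n^'m"
  shows "norm M = sqrt (\<Sum>i\<in>UNIV. \<Sum>j\<in>UNIV. (M $ i $ j)^2)"
  by (simp add: norm_vec_def L2_set_def sum_nonneg)

end

theory Submission imports Defs
begin

text \<open>Put \<open>N = B\<^sup>-\<^sup>1 A D\<^sup>1\<^sup>/\<^sup>2\<close>. If \<open>N\<^sup>T N x = l x\<close> with \<open>x \<noteq> 0\<close>, then testing the two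
  hypotheses on \<open>B\<^sup>-\<^sup>T N x\<close> gives \<open>(1 - \<epsilon>) l \<le> 1 \<le> (1 + \<epsilon>) l\<close>, hence
  \<open>\<bar>\<surd>l - 1\<bar> \<le> \<epsilon>\<close> in the given range of \<open>\<epsilon>\<close>. So the singular values of \<open>N\<close> differ from \<open>1\<close>
  by at most \<open>\<epsilon>\<close>, and replacing them all by \<open>1\<close> in a singular value decomposition yields the
  rotation.\<close>

section \<open>Spectral theorem for real symmetric matrices\<close>

text \<open>A maximiser \<open>v\<close> of \<open>x \<bullet> f x\<close> on the compact unit
  sphere of \<open>S\<close> works: the residual \<open>w = f v - l v\<close> stays in
  \<open>S\<close> by invariance, and a nonzero \<open>w\<close> would be a direction in which the
  Rayleigh quotient still increases.\<close>

lemma self_adjoint_eigenvector_in_subspace: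
  fixes f :: "'a::euclidean_space \<Rightarrow> 'a"
  assumes "linear f" and self_adjoint: "\<And>x y. x \<bullet> f y = f x \<bullet> y"
    and S: "subspace S" "S \<noteq> {0}" and inv: "f ` S \<subseteq> S"
  obtains v l where "v \<in> S" "norm v = 1" "f v = l *\<^sub>R v"
proof -
  interpret f: linear f by fact
  let ?K = "S \<inter> sphere 0 1"
  have "0 \<in> S" using S(1) by (rule subspace_0)
  then obtain s where s: "s \<in> S" "s \<noteq> 0" using S(2) by blast
  have "s /\<^sub>R norm s \<in> ?K"
    using s by (simp add: subspace_scale[OF S(1)])
  then have "?K \<noteq> {}" by blast
  moreover have "compact ?K"
    by (intro closed_Int_compact closed_subspace S(1) compact_sphere)
  moreover have "continuous_on ?K (\<lambda>x. x \<bullet> f x)"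
    by (intro continuous_intros linear_continuous_on)
      (simp add: \<open>linear f\<close> linear_conv_bounded_linear[symmetric])
  ultimately obtain v where v: "v \<in> ?K" and max: "\<And>x. x \<in> ?K \<Longrightarrow> x \<bullet> f x \<le> v \<bullet> f v"
    using continuous_attains_sup[of ?K "\<lambda>x. x \<bullet> f x"] by blast
  define l where "l = v \<bullet> f v"
  have vv: "v \<bullet> v = 1" using v by (simp add: dot_square_norm)
  have rayleigh: "x \<bullet> f x \<le> l * (x \<bullet> x)" if "x \<in> S" for x
  proof (cases "x = 0")
    case False
    have "x /\<^sub>R norm x \<in> ?K"
      using that False by (simp add: subspace_scale[OF S(1)])
    from max[OF this] have "(x \<bullet> f x) / (norm x)\<^sup>2 \<le> l"
      by (simp add: f.scaleR l_def power2_eq_square divide_simps)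
    then show ?thesis using False by (simp add: divide_simps dot_square_norm)
  qed (simp add: f.zero)
  define w where "w = f v - l *\<^sub>R v"
  define c where "c = l * (w \<bullet> w) - w \<bullet> f w"
  have w: "w \<in> S" using v inv S(1) by (auto simp: w_def intro!: subspace_diff subspace_scale)
  have fv: "f v = w + l *\<^sub>R v" by (simp add: w_def)
  have vw: "v \<bullet> w = 0" by (simp add: w_def inner_diff_right l_def[symmetric] vv)
  have vfw: "v \<bullet> f w = w \<bullet> w" by (simp add: self_adjoint fv inner_add_left vw)
  \<comment> \<open>This is the Rayleigh bound at \<open>v + t w\<close>: the constant terms both
    equal \<open>l\<close> and cancel, leaving a linear term against a quadratic one.\<close>
  have first_order: "2 * t * (w \<bullet> w) \<le> t\<^sup>2 * c" for t
  proof -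
    have "v + t *\<^sub>R w \<in> S" using v w S(1) by (auto intro!: subspace_add subspace_scale)
    from rayleigh[OF this] show ?thesis
      by (simp add: f.add f.scaleR inner_add_left inner_add_right vfw fv vw vv inner_commute[of w v]
          c_def power2_eq_square algebra_simps)
  qed
  have "w = 0"
  proof (rule ccontr)
    assume "w \<noteq> 0"
    define a where "a = w \<bullet> w"
    \<comment> \<open>This \<open>t\<close> is small enough for the linear term to win: it gives
      \<open>t * c \<le> a\<close>, whereas \<open>first_order\<close> divided by \<open>t\<close>
      demands \<open>2 * a \<le> t * c\<close>. The summand 1 keeps the denominator
      positive.\<close>
    define t where "t = a / (\<bar>c\<bar> + 1)"
    have a: "a > 0" using \<open>w \<noteq> 0\<close> by (simp add: a_def)
    then have t: "t > 0" by (simp add: t_def)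
    have "t * (2 * a) \<le> t * (t * c)"
      using first_order[of t] by (simp add: a_def power2_eq_square ac_simps)
    then have "2 * a \<le> t * c" using t by simp
    also have "\<dots> \<le> t * (\<bar>c\<bar> + 1)" using t by (intro mult_left_mono) auto
    also have "\<dots> = a" by (simp add: t_def)
    finally show False using a by simp
  qed
  then have "f v = l *\<^sub>R v" by (simp add: w_def)
  with v show thesis by (intro that[of v l]) auto
qed

text \<open>Induction on \<open>k\<close>: self-adjointness makes the orthogonal complement of the
  eigenvectors found so far invariant, and while \<open>k\<close> is below the dimension this
  complement is nonzero, so it contains a further unit eigenvector.\<close>

lemma self_adjoint_orthonormal_eigenvectors:
  fixes f :: "'a::euclidean_space \<Rightarrow> 'a"
  assumes "linear f" and self_adjoint: "\<And>x y. x \<bullet> f y = f x \<bullet> y" and "k \<le> DIM('a)"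
  shows "\<exists>E. finite E \<and> card E = k \<and> pairwise orthogonal E \<and>
    (\<forall>v\<in>E. norm v = 1 \<and> (\<exists>l. f v = l *\<^sub>R v))"
  using \<open>k \<le> DIM('a)\<close>
proof (induction k)
  case 0
  show ?case by (intro exI[of _ "{}"]) auto
next
  case (Suc k)
  then obtain E where E: "finite E" "card E = k" "pairwise orthogonal E"
    "\<forall>v\<in>E. norm v = 1 \<and> (\<exists>l. f v = l *\<^sub>R v)" by auto
  let ?S = "{y. \<forall>x\<in>E. orthogonal x y}"
  have "dim E < DIM('a)" using dim_le_card'[OF E(1)] E(2) Suc.prems by simp
  then obtain y where y: "y \<noteq> 0" "\<And>x. x \<in> span E \<Longrightarrow> orthogonal y x"
    using orthogonal_to_subspace_exists by blast
  have "y \<in> ?S" using y(2) by (auto simp: orthogonal_commute span_base)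
  with y(1) have "?S \<noteq> {0}" by blast
  moreover have "f ` ?S \<subseteq> ?S"
  proof clarsimp
    fix x y assume "\<forall>x\<in>E. orthogonal x y" "x \<in> E"
    then show "orthogonal x (f y)"
      using E(4) by (auto simp: orthogonal_def self_adjoint)
  qed
  ultimately obtain v l where v: "v \<in> ?S" "norm v = 1" "f v = l *\<^sub>R v"
    by (rule self_adjoint_eigenvector_in_subspace
        [OF \<open>linear f\<close> self_adjoint subspace_orthogonal_to_vectors])
  have "v \<notin> E"
    using v(1,2) by (auto simp: orthogonal_self)
  then show ?case
    using E v by (intro exI[of _ "insert v E"]) (auto simp: pairwise_insert orthogonal_commute)
qed

lemma symmetric_matrix_orthogonally_diagonalizable:
  fixes S :: "real^'n^'n"
  assumes "transpose S = S"
  obtains V and l :: "'n \<Rightarrow> real"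
  where "orthogonal_matrix V" "\<And>i. S *v column i V = l i *\<^sub>R column i V"
proof -
  have "x \<bullet> (S *v y) = (S *v x) \<bullet> y" for x y
    by (metis assms dot_lmul_matrix transpose_matrix_vector)
  then obtain E where E: "finite E" "card E = CARD('n)" "pairwise orthogonal E"
    "\<forall>v\<in>E. norm v = 1 \<and> (\<exists>l. S *v v = l *\<^sub>R v)"
    using self_adjoint_orthonormal_eigenvectors[of "(*v) S" "CARD('n)"]
    by (auto simp: matrix_vector_mul_linear)
  \<comment> \<open>Indexing the eigenvectors by \<open>'n\<close> lets them serve as columns;
    injectivity of \<open>h\<close> makes distinct columns orthogonal.\<close>
  obtain h where h: "bij_betw h (UNIV :: 'n set) E"
    using finite_same_card_bij[of "UNIV :: 'n set" E] E by auto
  then have hE: "h i \<in> E" for i by (auto simp: bij_betw_def)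
  define V where "V = (\<chi> i j. h j $ i)"
  have col: "column j V = h j" for j by (simp add: V_def column_def vec_eq_iff)
  have "orthogonal_matrix V"
    unfolding orthogonal_matrix_orthonormal_columns col
    using E(3,4) hE h by (simp add: bij_betw_def inj_eq pairwise_def)
  moreover have "\<forall>i. \<exists>l. S *v h i = l *\<^sub>R h i" using E(4) hE by blast
  then obtain l where "\<And>i. S *v h i = l i *\<^sub>R h i" unfolding choice_iff by blast
  ultimately show thesis using that[of V l] by (simp add: col)
qed

section \<open>Frobenius norm by columns and its orthogonal invariance\<close>

lemma norm_vec_power2:
  fixes x :: "'a::real_normed_vector^'n"
  shows "(norm x)\<^sup>2 = (\<Sum>i\<in>UNIV. (norm (x $ i))\<^sup>2)"
  by (simp add: norm_vec_def L2_set_def sum_nonneg)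

lemma norm_matrix_power2_columns:
  fixes M :: "real^'n^'m"
  shows "(norm M)\<^sup>2 = (\<Sum>j\<in>UNIV. (norm (column j M))\<^sup>2)"
proof -
  have "(norm M)\<^sup>2 = (\<Sum>i\<in>UNIV. \<Sum>j\<in>UNIV. (M $ i $ j)\<^sup>2)"
    by (simp add: norm_vec_power2)
  also have "\<dots> = (\<Sum>j\<in>UNIV. \<Sum>i\<in>UNIV. (M $ i $ j)\<^sup>2)"
    by (rule sum.swap)
  finally show ?thesis by (simp add: norm_vec_power2 column_def)
qed

lemma column_matrix_mult: "column j (M ** V) = M *v column j V"
  by (simp add: column_def matrix_matrix_mult_def matrix_vector_mult_def vec_eq_iff)

lemma norm_vector_orthogonal_matrix:
  fixes V :: "real^'n^'n"
  assumes "orthogonal_matrix V"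
  shows "norm (x v* V) = norm x"
proof -
  have "orthogonal_transformation ((*v) (transpose V))"
    using assms by (simp add: orthogonal_transformation_matrix del: transpose_matrix_vector)
  from orthogonal_transformation_norm[OF this, of x] show ?thesis by simp
qed

text \<open>Right multiplication by \<open>V\<close> acts on each row separately and preserves its
  length.\<close>

lemma norm_matrix_mult_orthogonal:
  fixes M :: "real^'n^'m" and V :: "real^'n^'n"
  assumes "orthogonal_matrix V"
  shows "norm (M ** V) = norm M"
proof -
  have "(M ** V) $ i = M $ i v* V" for i
    by (simp add: matrix_matrix_mult_def vector_matrix_mult_def vec_eq_iff)
  then have "(norm (M ** V))\<^sup>2 = (norm M)\<^sup>2"
    by (simp add: norm_vec_power2[where x = M] norm_vec_power2[where x = "M ** V"]
        norm_vector_orthogonal_matrix[OF assms])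
  then show ?thesis by simp
qed

section \<open>The nearby rotation from a singular value decomposition\<close>

text \<open>For orthonormal eigenvectors \<open>v i\<close> of \<open>transpose N ** N\<close>, the
  images \<open>N *v v i\<close> are orthogonal with lengths \<open>sqrt (l i)\<close>. If
  \<open>R\<close> sends each \<open>v i\<close> to the normalised image \<open>w i\<close>, then
  \<open>N - R\<close> sends it to a vector of length at most \<epsilon>, and the squares of these
  lengths add up to the squared Frobenius norm.\<close>

lemma orthogonal_matrix_near_if_singular_values_near_1:
  fixes N :: "real^'n^'n"
  assumes sv: "\<And>x l. \<lbrakk>x \<noteq> 0; (transpose N ** N) *v x = l *\<^sub>R x\<rbrakk> \<Longrightarrow> 0 < l \<and> \<bar>sqrt l - 1\<bar> \<le> \<epsilon>"
  shows "\<exists>R. orthogonal_matrix R \<and> norm (N - R) \<le> sqrt (real CARD('n)) * \<epsilon>"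
proof -
  have "transpose (transpose N ** N) = transpose N ** N"
    by (simp add: matrix_transpose_mul)
  then obtain V l where V: "orthogonal_matrix V"
    and eig: "\<And>i. (transpose N ** N) *v column i V = l i *\<^sub>R column i V"
    by (rule symmetric_matrix_orthogonally_diagonalizable) blast
  define v where "v = (\<lambda>i. column i V)"
  have v: "norm (v i) = 1" "i \<noteq> j \<Longrightarrow> v i \<bullet> v j = 0" for i j
    using V by (auto simp: v_def orthogonal_matrix_orthonormal_columns orthogonal_def)
  have l: "0 < l i" "\<bar>sqrt (l i) - 1\<bar> \<le> \<epsilon>" for i
  proof -
    have "v i \<noteq> 0" using v(1)[of i] by auto
    then show "0 < l i" "\<bar>sqrt (l i) - 1\<bar> \<le> \<epsilon>"
      using sv[of "v i" "l i"] eig[of i] by (simp_all add: v_def)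
  qed
  have \<epsilon>: "0 \<le> \<epsilon>" using l(2) abs_ge_zero order_trans by blast
  have NN: "(N *v v i) \<bullet> (N *v v j) = l j * (v i \<bullet> v j)" for i j
  proof -
    have "(N *v v i) \<bullet> (N *v v j) = v i \<bullet> ((transpose N ** N) *v v j)"
      by (simp add: inner_commute[of "v i"] dot_lmul_matrix inner_commute[of "N *v v j"]
          flip: matrix_vector_mul_assoc)
    then show ?thesis using eig by (simp add: v_def)
  qed
  define w where "w = (\<lambda>i. (1 / sqrt (l i)) *\<^sub>R (N *v v i))"
  have Nv: "N *v v i = sqrt (l i) *\<^sub>R w i" for i
    using l(1)[of i] by (simp add: w_def)
  have w: "norm (w i) = 1" "i \<noteq> j \<Longrightarrow> w i \<bullet> w j = 0" for i j
  proof -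
    have "w i \<bullet> w i = 1"
      using l(1)[of i] v(1)[of i] by (simp add: w_def NN norm_eq_1)
    then show "norm (w i) = 1" by (simp add: norm_eq_1)
    show "w i \<bullet> w j = 0" if "i \<noteq> j" using that v(2) by (simp add: w_def NN)
  qed
  define W where "W = (\<chi> i j. w j $ i)"
  have col: "column j W = w j" for j by (simp add: W_def column_def vec_eq_iff)
  have W: "orthogonal_matrix W"
    unfolding orthogonal_matrix_orthonormal_columns col using w by (auto simp: orthogonal_def)
  define R where "R = W ** transpose V"
  have R: "orthogonal_matrix R"
    using V W by (simp add: R_def orthogonal_matrix_mul)
  have "R ** V = W"
    using V by (simp add: R_def orthogonal_matrix flip: matrix_mul_assoc)
  \<comment> \<open>Multiplying by \<open>V\<close> keeps the norm and makes column \<open>j\<close>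
    the error on \<open>v j\<close>.\<close>
  then have "(N - R) ** V = N ** V - W"
    by (simp add: matrix_matrix_mult_def vec_eq_iff left_diff_distrib sum_subtractf)
  moreover have "column j (N ** V - W) = (sqrt (l j) - 1) *\<^sub>R w j" for j
  proof -
    have "column j (N ** V - W) = column j (N ** V) - column j W"
      by (simp add: column_def vec_eq_iff)
    then show ?thesis by (simp add: column_matrix_mult col Nv[unfolded v_def] scaleR_left_diff_distrib)
  qed
  ultimately have "(norm ((N - R) ** V))\<^sup>2 = (\<Sum>j\<in>UNIV. (sqrt (l j) - 1)\<^sup>2)"
    by (simp add: norm_matrix_power2_columns w)
  then have "(norm (N - R))\<^sup>2 = (\<Sum>j\<in>UNIV. (sqrt (l j) - 1)\<^sup>2)"
    by (simp only: norm_matrix_mult_orthogonal[OF V])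
  also have "\<dots> \<le> (\<Sum>j\<in>(UNIV::'n set). \<epsilon>\<^sup>2)"
    using l(2) \<epsilon> by (intro sum_mono) (simp add: power2_le_iff_abs_le)
  also have "\<dots> = (sqrt (real CARD('n)) * \<epsilon>)\<^sup>2"
    by (simp add: power_mult_distrib)
  finally have "norm (N - R) \<le> sqrt (real CARD('n)) * \<epsilon>"
    by (rule power2_le_imp_le) (simp add: \<epsilon>)
  with R show ?thesis by blast
qed

section \<open>Scalar estimate for one singular value\<close>

text \<open>The upper bound on \<open>sqrt l\<close> rests on
  \<open>(1 - \<epsilon>) * (1 + \<epsilon>)\<^sup>2 \<ge> 1\<close>. The excess over 1 is
  \<epsilon> (1 - \<epsilon> - \<epsilon>^2), and (sqrt 5 - 1) / 2 is the positive root of its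
  second factor. The lower bound rests on
  \<open>(1 + \<epsilon>) * (1 - \<epsilon>)\<^sup>2 \<le> 1\<close>, which holds for 0 \<le>
  \<epsilon> < 1.\<close>

lemma abs_sqrt_minus_1_le:
  fixes l \<epsilon> :: real
  assumes "0 < l" "(1 - \<epsilon>) * l \<le> 1" "1 \<le> (1 + \<epsilon>) * l" "\<epsilon> \<le> (sqrt 5 - 1) / 2"
  shows "\<bar>sqrt l - 1\<bar> \<le> \<epsilon>"
proof -
  have "(1 - \<epsilon>) * l \<le> (1 + \<epsilon>) * l" using assms by linarith
  then have \<epsilon>: "0 \<le> \<epsilon>" using assms(1) by simp
  have "sqrt 5 < 3" by (rule real_less_lsqrt) auto
  then have "(sqrt 5 - 1) / 2 < 1" by simp
  with assms(4) have \<epsilon>1: "\<epsilon> < 1" by (rule le_less_trans)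
  have "(2 * \<epsilon> + 1)\<^sup>2 \<le> (sqrt 5)\<^sup>2" using \<epsilon> assms(4) by (intro power_mono) auto
  then have golden: "\<epsilon>\<^sup>2 + \<epsilon> \<le> 1" by (simp add: power2_eq_square algebra_simps)
  have "(1 - \<epsilon>) * l \<le> (1 - \<epsilon>) * (1 + \<epsilon>)\<^sup>2"
  proof -
    have "0 \<le> \<epsilon> * (1 - (\<epsilon>\<^sup>2 + \<epsilon>))" using \<epsilon> golden by simp
    then have "1 \<le> (1 - \<epsilon>) * (1 + \<epsilon>)\<^sup>2" by (simp add: power2_eq_square algebra_simps)
    with assms(2) show ?thesis by linarith
  qed
  then have "l \<le> (1 + \<epsilon>)\<^sup>2" using \<epsilon>1 by simp
  then have upper: "sqrt l \<le> 1 + \<epsilon>" using \<epsilon> by (intro real_le_lsqrt) (use assms(1) in auto)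
  have "(1 + \<epsilon>) * (1 - \<epsilon>)\<^sup>2 \<le> (1 + \<epsilon>) * l"
  proof -
    have "0 \<le> \<epsilon> * (1 - \<epsilon>) + \<epsilon>\<^sup>2 * (2 - \<epsilon>)" using \<epsilon> \<epsilon>1 by simp
    then have "(1 + \<epsilon>) * (1 - \<epsilon>)\<^sup>2 \<le> 1" by (simp add: power2_eq_square algebra_simps)
    with assms(3) show ?thesis by linarith
  qed
  then have "(1 - \<epsilon>)\<^sup>2 \<le> l" using \<epsilon> by simp
  then have "1 - \<epsilon> \<le> sqrt l" by (rule real_le_rsqrt)
  with upper show ?thesis by linarith
qed

section \<open>From the Loewner bounds to the singular values\<close>

lemma inner_mult_transpose:
  fixes M :: "real^'n^'m"
  shows "z \<bullet> ((M ** transpose M) *v z) = (norm (z v* M))\<^sup>2"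
  by (simp add: dot_square_norm[symmetric] dot_lmul_matrix flip: matrix_vector_mul_assoc)

lemma loewner_leD: "M \<preceq> N \<Longrightarrow> x \<bullet> (M *v x) \<le> x \<bullet> (N *v x)"
  by (simp add: loewner_le_def psd_def matrix_vector_mult_diff_rdistrib inner_diff_right)

theorem lemma2p11:
  fixes A B Mhat :: "real^'n^'n" and u0 :: "real^'n" and \<epsilon> :: real
  assumes "\<epsilon> \<le> (sqrt 5 - 1) / 2"
    and "(1 - \<epsilon>) *\<^sub>R (A ** D_mat A u0 ** transpose A) \<preceq> Mhat"
    and "Mhat \<preceq> (1 + \<epsilon>) *\<^sub>R (A ** D_mat A u0 ** transpose A)"
    and "Mhat = B ** transpose B"
    and "invertible B"
  shows "\<exists>R. orthogonal_matrix R \<and>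
    norm (matrix_inv B ** A ** diag_sqrt (D_mat A u0) - R) \<le> sqrt (real CARD('n)) * \<epsilon>"
proof (rule orthogonal_matrix_near_if_singular_values_near_1)
  define C where "C = A ** diag_sqrt (D_mat A u0)"
  define N where "N = matrix_inv B ** A ** diag_sqrt (D_mat A u0)"
  have inv: "B ** matrix_inv B = mat 1" "matrix_inv B ** B = mat 1"
    using someI_ex[OF \<open>invertible B\<close>[unfolded invertible_def]] by (auto simp: matrix_inv_def)
  have C: "C = B ** N"
    by (simp add: C_def N_def matrix_mul_assoc inv(1))
  have ADA: "A ** D_mat A u0 ** transpose A = C ** transpose C"
  proof -
    have "C ** transpose C =
        A ** (diag_sqrt (D_mat A u0) ** diag_sqrt (D_mat A u0)) ** transpose A"
      using psd_diag_sqrt_D_mat[of A u0]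
      by (simp add: C_def matrix_transpose_mul psd_def matrix_mul_assoc)
    then show ?thesis by (simp add: diag_sqrt_D_mat_square)
  qed
  have lower: "(1 - \<epsilon>) * (norm (y v* N))\<^sup>2 \<le> (norm y)\<^sup>2"
    and upper: "(norm y)\<^sup>2 \<le> (1 + \<epsilon>) * (norm (y v* N))\<^sup>2" for y
  proof -
    \<comment> \<open>Testing at this \<open>z\<close> cancels \<open>B\<close>: the form of
      \<open>B ** transpose B\<close> becomes the squared length of \<open>y\<close>, and that of
      \<open>C ** transpose C\<close> the squared length of \<open>y v* N\<close>.\<close>
    define z where "z = y v* matrix_inv B"
    have zB: "z v* B = y" by (simp add: z_def vector_matrix_mul_assoc inv(2))
    then have zC: "z v* C = y v* N" by (simp add: C flip: vector_matrix_mul_assoc)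
    show "(1 - \<epsilon>) * (norm (y v* N))\<^sup>2 \<le> (norm y)\<^sup>2"
      using loewner_leD[OF assms(2), of z]
      by (simp add: ADA assms(4) scaleR_matrix_vector_assoc[symmetric] inner_mult_transpose zB zC
          del: transpose_matrix_vector)
    show "(norm y)\<^sup>2 \<le> (1 + \<epsilon>) * (norm (y v* N))\<^sup>2"
      using loewner_leD[OF assms(3), of z]
      by (simp add: ADA assms(4) scaleR_matrix_vector_assoc[symmetric] inner_mult_transpose zB zC
          del: transpose_matrix_vector)
  qed
  \<comment> \<open>The upper estimate forces a trivial kernel for \<open>transpose N\<close>; as
    the matrix is square, \<open>N\<close> is injective too. This is what makes \<open>l\<close>
    strictly positive below.\<close>
  have "y = 0" if "transpose N *v y = 0" for y
    using upper[of y] that by simp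
  then have "invertible (transpose N)"
    using matrix_left_invertible_ker invertible_left_inverse by blast
  then have N_inj: "x = 0" if "N *v x = 0" for x
    using that matrix_left_invertible_ker invertible_left_inverse
      transpose_invertible[of "transpose N"]
    by (metis transpose_transpose)
  fix x l
  assume x: "x \<noteq> 0" and "(transpose (matrix_inv B ** A ** diag_sqrt (D_mat A u0)) **
      (matrix_inv B ** A ** diag_sqrt (D_mat A u0))) *v x = l *\<^sub>R x"
  then have eig: "(N *v x) v* N = l *\<^sub>R x"
    by (simp add: N_def flip: matrix_vector_mul_assoc)
  have "l * (norm x)\<^sup>2 = x \<bullet> ((N *v x) v* N)"
    by (simp add: eig dot_square_norm)
  also have "\<dots> = (norm (N *v x))\<^sup>2"
    by (simp add: inner_commute[of x] dot_lmul_matrix dot_square_norm)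
  finally have Nx: "(norm (N *v x))\<^sup>2 = l * (norm x)\<^sup>2" by simp
  moreover have "0 < (norm (N *v x))\<^sup>2" using N_inj x by auto
  ultimately have l: "0 < l" by (metis zero_less_mult_pos2 x zero_less_norm_iff zero_less_power)
  have pos: "0 < l * (norm x)\<^sup>2" using l x by simp
  have NNx: "(norm ((N *v x) v* N))\<^sup>2 = l * (l * (norm x)\<^sup>2)"
    using l by (simp add: eig power2_eq_square)
  \<comment> \<open>At \<open>y = N *v x\<close> both estimates compare multiples of
    \<open>l * (norm x)\<^sup>2\<close>, since applying \<open>transpose N\<close> to
    \<open>y\<close> contributes one more factor \<open>l\<close>. This positive quantity then
    cancels.\<close>
  have "((1 - \<epsilon>) * l) * (l * (norm x)\<^sup>2) \<le> 1 * (l * (norm x)\<^sup>2)"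
    using lower[of "N *v x"] by (simp only: NNx Nx mult.assoc mult_1)
  then have "(1 - \<epsilon>) * l \<le> 1"
    using pos by (metis mult_le_cancel_right_pos)
  moreover have "1 * (l * (norm x)\<^sup>2) \<le> ((1 + \<epsilon>) * l) * (l * (norm x)\<^sup>2)"
    using upper[of "N *v x"] by (simp only: NNx Nx mult.assoc mult_1)
  then have "1 \<le> (1 + \<epsilon>) * l"
    using pos by (metis mult_le_cancel_right_pos)
  ultimately show "0 < l \<and> \<bar>sqrt l - 1\<bar> \<le> \<epsilon>"
    using l abs_sqrt_minus_1_le[of l \<epsilon>] assms(1) by blast
qed

end
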